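(* Let $(\bar M,P,g)$ be a Golden Riemannian manifold, let $(M_1,g_1,J_1)$ be a metallic Riemannian manifold with $J_1^2=pJ_1+qI$, where $p,q$ are positive integers, and let $F:\bar M\to M_1$ be a smooth map such that $F_*P=J_1F_*$. Let $\phi=\frac{1+\sqrt5}{2}$. If $p\neq q\phi+(1-\phi)$ and $p\neq q(1-\phi)+\phi$, then $F$ is a constant map.
   Context: All manifolds and maps are $C^\infty$; $F_*$ is the differential of $F$. A metallic Riemannian manifold $(M,g,J)$ is a Riemannian manifold $(M,g)$ with a $(1,1)$-tensor field $J$ such that $J^2=pJ+qI$ for some positive integers $p,q$ ($I$ the identity) and $g(JX,Y)=g(X,JY)$ for all vector fields $X,Y$; it is assumed throughout that $\nabla J=0$ for the Levi-Civita connection $\nabla$ of $g$. A Golden Riemannian manifold $(\bar M,P,g)$ is a Riemannian manifold $(\bar M,g)$ with a $(1,1)$-tensor field $P$ such that $P^2=P+I$ and $g(PX,Y)=g(X,PY)$ for all vector fields $X,Y$.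
   Formalization: The domain manifold is assumed connected, since otherwise a locally constant map taking different values on different components meets all hypotheses without being constant; manifolds have dimension at least 1 (dimension 0 is trivial). *)

theory Defs
  imports "HOL-Analysis.Analysis"
begin

section \<open>Smooth maps between open subsets of Euclidean spaces\<close>

text \<open>Only used for open \<open>S\<close>, where \<open>C_diff k S f\<close> says that \<open>f\<close> is of class \<open>C\<^sup>k\<close> on \<open>S\<close>:
  all iterated directional derivatives up to order \<open>k\<close> exist and are continuous.\<close>

primrec C_diff :: "nat \<Rightarrow> 'e::euclidean_space set \<Rightarrow> ('e \<Rightarrow> 'f::real_normed_vector) \<Rightarrow> bool" where
  "C_diff 0 S f \<longleftrightarrow> continuous_on S f"
| "C_diff (Suc k) S f \<longleftrightarrow>
     (\<forall>y\<in>S. f differentiable (at y)) \<and> (\<forall>u. C_diff k S (\<lambda>y. frechet_derivative f (at y) u))"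

definition smooth_on :: "'e::euclidean_space set \<Rightarrow> ('e \<Rightarrow> 'f::real_normed_vector) \<Rightarrow> bool" where
  "smooth_on S f \<longleftrightarrow> (\<forall>k. C_diff k S f)"

section \<open>Smooth manifolds\<close>

text \<open>A chart is a pair of its domain and its coordinate map; the values of the coordinate map
  outside the domain are irrelevant.\<close>

type_synonym ('a, 'e) chart = "'a set \<times> ('a \<Rightarrow> 'e)"

abbreviation cdom :: "('a, 'e) chart \<Rightarrow> 'a set" where
  "cdom \<equiv> fst"

abbreviation cmap :: "('a, 'e) chart \<Rightarrow> 'a \<Rightarrow> 'e" where
  "cmap \<equiv> snd"

definition crange :: "('a, 'e) chart \<Rightarrow> 'e set" where
  "crange c = cmap c ` cdom c"

definition cinv :: "('a, 'e) chart \<Rightarrow> 'e \<Rightarrow> 'a" where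
  "cinv c = inv_into (cdom c) (cmap c)"

text \<open>The atlas \<open>A\<close> represents the smooth structure it generates; it need not be maximal. All notions
  below depend on \<open>A\<close> only through that structure. The dimension is \<open>DIM('e)\<close>.\<close>

locale smooth_manifold =
  fixes M :: "'a topology" and A :: "('a, 'e::euclidean_space) chart set"
  assumes Hausdorff: "Hausdorff_space M"
    and second_countable: "second_countable M"
    and charts_cover: "(\<Union>c\<in>A. cdom c) = topspace M"
    and chart_domain_open: "c \<in> A \<Longrightarrow> openin M (cdom c)"
    and chart_range_open: "c \<in> A \<Longrightarrow> open (crange c)"
    and chart_homeomorphic:
      "c \<in> A \<Longrightarrow> homeomorphic_map (subtopology M (cdom c)) (top_of_set (crange c)) (cmap c)"
    and charts_compatible:
      "c \<in> A \<Longrightarrow> d \<in> A \<Longrightarrow> smooth_on (cmap c ` (cdom c \<inter> cdom d)) (cmap d \<circ> cinv c)"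

definition smooth_function :: "('a, 'e::euclidean_space) chart set \<Rightarrow> ('a \<Rightarrow> real) \<Rightarrow> bool" where
  "smooth_function A f \<longleftrightarrow> (\<forall>c\<in>A. smooth_on (crange c) (f \<circ> cinv c))"

definition smooth_map :: "'a topology \<Rightarrow> ('a, 'e::euclidean_space) chart set \<Rightarrow>
    'b topology \<Rightarrow> ('b, 'f::euclidean_space) chart set \<Rightarrow> ('a \<Rightarrow> 'b) \<Rightarrow> bool" where
  "smooth_map M A N B F \<longleftrightarrow> continuous_map M N F \<and>
     (\<forall>c\<in>A. \<forall>d\<in>B. smooth_on (cmap c ` {x \<in> cdom c. F x \<in> cdom d}) (cmap d \<circ> F \<circ> cinv c))"

section \<open>Tangent vectors and the differential\<close>

text \<open>A tangent vector at \<open>x\<close> is a family \<open>v\<close> of coordinate vectors, \<open>v c\<close> being its coordinates in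
  the chart \<open>c\<close>, related by the derivatives of the changes of coordinates. The vector space
  operations are those of families. For charts not containing \<open>x\<close> the entry is \<open>0\<close>; in particular
  \<open>tangent_space A x\<close> contains only the zero family if \<open>x\<close> is not a point of the manifold.\<close>

definition chart_change :: "'a \<Rightarrow> ('a, 'e::euclidean_space) chart \<Rightarrow> ('a, 'e) chart \<Rightarrow> 'e \<Rightarrow> 'e" where
  "chart_change x c d = frechet_derivative (cmap d \<circ> cinv c) (at (cmap c x))"

definition tangent_space ::
    "('a, 'e::euclidean_space) chart set \<Rightarrow> 'a \<Rightarrow> (('a, 'e) chart \<Rightarrow> 'e) set" where
  "tangent_space A x = {v.
     (\<forall>c. \<not> (c \<in> A \<and> x \<in> cdom c) \<longrightarrow> v c = 0) \<and>
     (\<forall>c\<in>A. \<forall>d\<in>A. x \<in> cdom c \<longrightarrow> x \<in> cdom d \<longrightarrow> v d = chart_change x c d (v c))}"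

text \<open>The tangent vector at \<open>x\<close> with coordinates \<open>u\<close> in the chart \<open>c\<close>; for a basis vector \<open>u\<close> this is a
  coordinate vector field of \<open>c\<close> at \<open>x\<close>.\<close>

definition coord_vector :: "('a, 'e::euclidean_space) chart set \<Rightarrow> ('a, 'e) chart \<Rightarrow> 'a \<Rightarrow> 'e \<Rightarrow>
    ('a, 'e) chart \<Rightarrow> 'e" where
  "coord_vector A c x u = (\<lambda>d. if d \<in> A \<and> x \<in> cdom d then chart_change x c d u else 0)"

definition some_chart :: "('a, 'e) chart set \<Rightarrow> 'a \<Rightarrow> ('a, 'e) chart" where
  "some_chart A x = (SOME c. c \<in> A \<and> x \<in> cdom c)"

text \<open>The differential of \<open>F\<close> at \<open>x\<close>. By the chain rule its value on a tangent vector does not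
  depend on the chart chosen around \<open>x\<close>. The same applies to the directional derivative below.\<close>

definition differential :: "('a, 'e::euclidean_space) chart set \<Rightarrow> ('b, 'f::euclidean_space) chart set \<Rightarrow>
    ('a \<Rightarrow> 'b) \<Rightarrow> 'a \<Rightarrow> (('a, 'e) chart \<Rightarrow> 'e) \<Rightarrow> ('b, 'f) chart \<Rightarrow> 'f" where
  "differential A B F x v = (\<lambda>d. if d \<in> B \<and> F x \<in> cdom d
     then let c = some_chart A x in frechet_derivative (cmap d \<circ> F \<circ> cinv c) (at (cmap c x)) (v c)
     else 0)"

definition dir_derivative :: "('a, 'e::euclidean_space) chart set \<Rightarrow> ('a \<Rightarrow> real) \<Rightarrow> 'a \<Rightarrow>
    (('a, 'e) chart \<Rightarrow> 'e) \<Rightarrow> real" where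
  "dir_derivative A f x v =
     (let c = some_chart A x in frechet_derivative (f \<circ> cinv c) (at (cmap c x)) (v c))"

section \<open>Vector fields and tensor fields\<close>

type_synonym ('a, 'e) vfield = "'a \<Rightarrow> ('a, 'e) chart \<Rightarrow> 'e"

definition vector_field :: "('a, 'e::euclidean_space) chart set \<Rightarrow> ('a, 'e) vfield \<Rightarrow> bool" where
  "vector_field A X \<longleftrightarrow> (\<forall>x. X x \<in> tangent_space A x) \<and>
     (\<forall>c\<in>A. smooth_on (crange c) (\<lambda>y. X (cinv c y) c))"

definition lie_bracket :: "('a, 'e::euclidean_space) chart set \<Rightarrow> ('a, 'e) vfield \<Rightarrow> ('a, 'e) vfield \<Rightarrow>
    ('a, 'e) vfield" where
  "lie_bracket A X Y = (\<lambda>x c. if c \<in> A \<and> x \<in> cdom c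
     then frechet_derivative (\<lambda>y. Y (cinv c y) c) (at (cmap c x)) (X x c)
        - frechet_derivative (\<lambda>y. X (cinv c y) c) (at (cmap c x)) (Y x c)
     else 0)"

text \<open>A smooth (1,1)-tensor field: a linear endomorphism of each tangent space whose components in
  every chart are smooth.\<close>

definition tensor_field_11 :: "('a, 'e::euclidean_space) chart set \<Rightarrow>
    ('a \<Rightarrow> (('a, 'e) chart \<Rightarrow> 'e) \<Rightarrow> (('a, 'e) chart \<Rightarrow> 'e)) \<Rightarrow> bool" where
  "tensor_field_11 A J \<longleftrightarrow>
     (\<forall>x. \<forall>v\<in>tangent_space A x. J x v \<in> tangent_space A x) \<and>
     (\<forall>x a b. \<forall>v\<in>tangent_space A x. \<forall>w\<in>tangent_space A x.
        J x (\<lambda>c. a *\<^sub>R v c + b *\<^sub>R w c) = (\<lambda>c. a *\<^sub>R J x v c + b *\<^sub>R J x w c)) \<and>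
     (\<forall>c\<in>A. \<forall>u. smooth_on (crange c)
        (\<lambda>y. J (cinv c y) (coord_vector A c (cinv c y) u) c))"

definition riemannian_metric :: "('a, 'e::euclidean_space) chart set \<Rightarrow>
    ('a \<Rightarrow> (('a, 'e) chart \<Rightarrow> 'e) \<Rightarrow> (('a, 'e) chart \<Rightarrow> 'e) \<Rightarrow> real) \<Rightarrow> bool" where
  "riemannian_metric A g \<longleftrightarrow>
     (\<forall>x. \<forall>v\<in>tangent_space A x. \<forall>w\<in>tangent_space A x. g x v w = g x w v) \<and>
     (\<forall>x a b. \<forall>v\<in>tangent_space A x. \<forall>w\<in>tangent_space A x. \<forall>z\<in>tangent_space A x.
        g x (\<lambda>c. a *\<^sub>R v c + b *\<^sub>R w c) z = a * g x v z + b * g x w z) \<and>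
     (\<forall>x. \<forall>v\<in>tangent_space A x. v \<noteq> (\<lambda>c. 0) \<longrightarrow> g x v v > 0) \<and>
     (\<forall>c\<in>A. \<forall>u w. smooth_on (crange c)
        (\<lambda>y. g (cinv c y) (coord_vector A c (cinv c y) u) (coord_vector A c (cinv c y) w)))"

locale riemannian_manifold = smooth_manifold M A
  for M :: "'a topology" and A :: "('a, 'e::euclidean_space) chart set" +
  fixes g :: "'a \<Rightarrow> (('a, 'e) chart \<Rightarrow> 'e) \<Rightarrow> (('a, 'e) chart \<Rightarrow> 'e) \<Rightarrow> real"
  assumes metric: "riemannian_metric A g"

section \<open>The Levi-Civita connection\<close>

definition affine_connection :: "('a, 'e::euclidean_space) chart set \<Rightarrow>
    (('a, 'e) vfield \<Rightarrow> ('a, 'e) vfield \<Rightarrow> ('a, 'e) vfield) \<Rightarrow> bool" where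
  "affine_connection A nabla \<longleftrightarrow>
     (\<forall>X Y. vector_field A X \<longrightarrow> vector_field A Y \<longrightarrow> vector_field A (nabla X Y)) \<and>
     (\<forall>X Y Z. vector_field A X \<longrightarrow> vector_field A Y \<longrightarrow> vector_field A Z \<longrightarrow>
        nabla (\<lambda>x c. X x c + Y x c) Z = (\<lambda>x c. nabla X Z x c + nabla Y Z x c) \<and>
        nabla X (\<lambda>x c. Y x c + Z x c) = (\<lambda>x c. nabla X Y x c + nabla X Z x c)) \<and>
     (\<forall>f X Y. smooth_function A f \<longrightarrow> vector_field A X \<longrightarrow> vector_field A Y \<longrightarrow>
        nabla (\<lambda>x c. f x *\<^sub>R X x c) Y = (\<lambda>x c. f x *\<^sub>R nabla X Y x c) \<and>
        nabla X (\<lambda>x c. f x *\<^sub>R Y x c) =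
          (\<lambda>x c. f x *\<^sub>R nabla X Y x c + dir_derivative A f x (X x) *\<^sub>R Y x c))"

definition levi_civita_connection :: "'a topology \<Rightarrow> ('a, 'e::euclidean_space) chart set \<Rightarrow>
    ('a \<Rightarrow> (('a, 'e) chart \<Rightarrow> 'e) \<Rightarrow> (('a, 'e) chart \<Rightarrow> 'e) \<Rightarrow> real) \<Rightarrow>
    (('a, 'e) vfield \<Rightarrow> ('a, 'e) vfield \<Rightarrow> ('a, 'e) vfield) \<Rightarrow> bool" where
  "levi_civita_connection M A g nabla \<longleftrightarrow> affine_connection A nabla \<and>
     (\<forall>X Y. vector_field A X \<longrightarrow> vector_field A Y \<longrightarrow>
        (\<lambda>x c. nabla X Y x c - nabla Y X x c) = lie_bracket A X Y) \<and>
     (\<forall>X Y Z. vector_field A X \<longrightarrow> vector_field A Y \<longrightarrow> vector_field A Z \<longrightarrow>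
        (\<forall>x\<in>topspace M. dir_derivative A (\<lambda>z. g z (Y z) (Z z)) x (X x) =
           g x (nabla X Y x) (Z x) + g x (Y x) (nabla X Z x)))"

section \<open>Golden and metallic Riemannian manifolds\<close>

locale golden_riemannian_manifold = riemannian_manifold M A g
  for M :: "'a topology" and A :: "('a, 'e::euclidean_space) chart set" and g +
  fixes P :: "'a \<Rightarrow> (('a, 'e) chart \<Rightarrow> 'e) \<Rightarrow> (('a, 'e) chart \<Rightarrow> 'e)"
  assumes tensor_field: "tensor_field_11 A P"
    and golden: "x \<in> topspace M \<Longrightarrow> v \<in> tangent_space A x \<Longrightarrow>
      P x (P x v) = (\<lambda>c. P x v c + v c)"
    and compatible: "vector_field A X \<Longrightarrow> vector_field A Y \<Longrightarrow> x \<in> topspace M \<Longrightarrow>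
      g x (P x (X x)) (Y x) = g x (X x) (P x (Y x))"

text \<open>The Levi-Civita connection is unique on smooth vector fields, so the existential
  quantifier in \<open>parallel\<close> just refers to the Levi-Civita connection of \<open>g\<close>; the equation there is
  \<open>(\<nabla>\<^sub>X J) Y = 0\<close>.\<close>

locale metallic_riemannian_manifold = riemannian_manifold M A g
  for M :: "'a topology" and A :: "('a, 'e::euclidean_space) chart set" and g +
  fixes J :: "'a \<Rightarrow> (('a, 'e) chart \<Rightarrow> 'e) \<Rightarrow> (('a, 'e) chart \<Rightarrow> 'e)" and p q :: nat
  assumes p_pos: "p > 0" and q_pos: "q > 0"
    and tensor_field: "tensor_field_11 A J"
    and metallic: "x \<in> topspace M \<Longrightarrow> v \<in> tangent_space A x \<Longrightarrow>
      J x (J x v) = (\<lambda>c. real p *\<^sub>R J x v c + real q *\<^sub>R v c)"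
    and compatible: "vector_field A X \<Longrightarrow> vector_field A Y \<Longrightarrow> x \<in> topspace M \<Longrightarrow>
      g x (J x (X x)) (Y x) = g x (X x) (J x (Y x))"
    and parallel: "\<exists>nabla. levi_civita_connection M A g nabla \<and>
      (\<forall>X Y. vector_field A X \<longrightarrow> vector_field A Y \<longrightarrow>
         nabla X (\<lambda>x. J x (Y x)) = (\<lambda>x. J x (nabla X Y x)))"

end

theory Submission
  imports Defs
begin

text \<open>A vector \<open>w\<close> in the image of \<open>F\<^sub>*\<close> satisfies both \<open>J\<^sup>2w = Jw + w\<close>, transported from the Golden
  structure, and \<open>J\<^sup>2w = pJw + qw\<close>; subtracting, \<open>(p - 1)Jw = (1 - q)w\<close>. If \<open>p \<noteq> 1\<close> and
  \<open>w \<noteq> 0\<close>, then \<open>(1 - q)/(p - 1)\<close> is a rational root of \<open>t\<^sup>2 = t + 1\<close>, which is impossible. If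
  \<open>p = 1\<close> and \<open>w \<noteq> 0\<close>, then \<open>q = 1\<close>, which the hypotheses on \<open>\<phi>\<close> exclude. Hence \<open>F\<^sub>* = 0\<close>, so
  \<open>F\<close> is locally constant, and connectedness finishes the proof.\<close>

section \<open>Coordinate maps\<close>

lemma smooth_on_differentiable:
  assumes "smooth_on S f" "y \<in> S"
  shows "f differentiable (at y)"
proof -
  have "C_diff (Suc 0) S f" using assms(1) unfolding smooth_on_def by blast
  then show ?thesis using assms(2) by simp
qed

context smooth_manifold
begin

lemma inj_on_cmap: "c \<in> A \<Longrightarrow> inj_on (cmap c) (cdom c)"
  using homeomorphic_imp_injective_map[OF chart_homeomorphic[of c]] charts_cover
  by (metis UN_upper inf.absorb_iff2 topspace_subtopology)

lemma cinv_cmap [simp]: "c \<in> A \<Longrightarrow> x \<in> cdom c \<Longrightarrow> cinv c (cmap c x) = x"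
  unfolding cinv_def by (simp add: inj_on_cmap)

lemma cinv_mem: "y \<in> crange c \<Longrightarrow> cinv c y \<in> cdom c"
  unfolding cinv_def crange_def by (rule inv_into_into)

lemma cmap_cinv: "y \<in> crange c \<Longrightarrow> cmap c (cinv c y) = y"
  unfolding cinv_def crange_def by (rule f_inv_into_f)

lemma cdom_topspace: "c \<in> A \<Longrightarrow> x \<in> cdom c \<Longrightarrow> x \<in> topspace M"
  using charts_cover by blast

lemma chart_at:
  assumes "x \<in> topspace M"
  obtains c where "c \<in> A" "x \<in> cdom c"
  using assms charts_cover by blast

lemma some_chart:
  assumes "x \<in> topspace M"
  shows "some_chart A x \<in> A" "x \<in> cdom (some_chart A x)"
proof -
  have "\<exists>c. c \<in> A \<and> x \<in> cdom c" using chart_at[OF assms] by blast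
  from someI_ex[OF this] show "some_chart A x \<in> A" "x \<in> cdom (some_chart A x)"
    unfolding some_chart_def by auto
qed

text \<open>The chart is a homeomorphism onto \<open>crange c\<close>, and relative openness there
  is openness because \<open>crange c\<close> is open. This supplies the neighbourhoods needed to
  replace a map by one agreeing with it near a point.\<close>

lemma open_cmap_image:
  assumes "c \<in> A" "openin M W" "W \<subseteq> cdom c"
  shows "open (cmap c ` W)"
proof -
  have "openin (subtopology M (cdom c)) W"
    using assms by (simp add: openin_open_subtopology chart_domain_open)
  then have "openin (top_of_set (crange c)) (cmap c ` W)"
    using homeomorphic_imp_open_map[OF chart_homeomorphic[OF assms(1)]] unfolding open_map_def
    by blast
  then show ?thesis using chart_range_open[OF assms(1)] openin_open_trans by blast
qed

lemma openin_chart_preimage: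
  assumes "c \<in> A" "open V"
  shows "openin M {x \<in> cdom c. cmap c x \<in> V}"
proof -
  have "openin (top_of_set (crange c)) (crange c \<inter> V)"
    using assms(2) by (simp add: openin_open_Int)
  then have "openin (subtopology M (cdom c))
      {x \<in> topspace (subtopology M (cdom c)). cmap c x \<in> crange c \<inter> V}"
    using homeomorphic_imp_continuous_map[OF chart_homeomorphic[OF assms(1)]]
    by (rule openin_continuous_map_preimage[rotated])
  moreover have "{x \<in> topspace (subtopology M (cdom c)). cmap c x \<in> crange c \<inter> V} =
      {x \<in> cdom c. cmap c x \<in> V}"
    using cdom_topspace[OF assms(1)] by (auto simp: crange_def)
  ultimately show ?thesis
    using chart_domain_open[OF assms(1)] openin_trans_full by metis
qed

text \<open>Makes a change of charts the coordinate form of a smooth map, so that the chain rules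
  below for maps also give the rules for \<open>chart_change\<close>.\<close>

lemma smooth_map_id: "smooth_map M A M A id"
  unfolding smooth_map_def
proof (intro conjI ballI)
  fix c d assume "c \<in> A" "d \<in> A"
  moreover have "{x \<in> cdom c. id x \<in> cdom d} = cdom c \<inter> cdom d" by auto
  ultimately show "smooth_on (cmap c ` {x \<in> cdom c. id x \<in> cdom d}) (cmap d \<circ> id \<circ> cinv c)"
    using charts_compatible by simp
qed simp

end

section \<open>The differential of a smooth map\<close>

locale smooth_manifold_map =
  source: smooth_manifold M A + target: smooth_manifold N B
  for M :: "'a topology" and A :: "('a, 'e::euclidean_space) chart set"
    and N :: "'b topology" and B :: "('b, 'f::euclidean_space) chart set" +
  fixes F :: "'a \<Rightarrow> 'b"
  assumes smooth: "smooth_map M A N B F"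
begin

lemma continuous: "continuous_map M N F"
  using smooth unfolding smooth_map_def by blast

lemma maps_to: "x \<in> topspace M \<Longrightarrow> F x \<in> topspace N"
  using continuous continuous_map_image_subset_topspace by blast

lemma open_coord_domain:
  assumes "c \<in> A" "d \<in> B"
  shows "open (cmap c ` {x \<in> cdom c. F x \<in> cdom d})"
proof (rule source.open_cmap_image)
  have "openin M (cdom c \<inter> {x \<in> topspace M. F x \<in> cdom d})"
    using assms source.chart_domain_open target.chart_domain_open
      openin_continuous_map_preimage[OF continuous] by blast
  moreover have "cdom c \<inter> {x \<in> topspace M. F x \<in> cdom d} = {x \<in> cdom c. F x \<in> cdom d}"
    using source.cdom_topspace[OF assms(1)] by auto
  ultimately show "openin M {x \<in> cdom c. F x \<in> cdom d}" by simp
qed (use assms in auto)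

lemma coord_has_derivative:
  assumes "c \<in> A" "d \<in> B" "x \<in> cdom c" "F x \<in> cdom d"
  shows "(cmap d \<circ> F \<circ> cinv c has_derivative
    frechet_derivative (cmap d \<circ> F \<circ> cinv c) (at (cmap c x))) (at (cmap c x))"
proof -
  have "cmap d \<circ> F \<circ> cinv c differentiable (at (cmap c x))"
  proof (rule smooth_on_differentiable)
    show "smooth_on (cmap c ` {x \<in> cdom c. F x \<in> cdom d}) (cmap d \<circ> F \<circ> cinv c)"
      using smooth assms unfolding smooth_map_def by blast
  qed (use assms in auto)
  then show ?thesis by (simp add: frechet_derivative_works)
qed

end

lemma (in smooth_manifold) chart_change_has_derivative:
  assumes "c \<in> A" "d \<in> A" "x \<in> cdom c" "x \<in> cdom d"
  shows "(cmap d \<circ> cinv c has_derivative chart_change x c d) (at (cmap c x))"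
proof -
  interpret identity: smooth_manifold_map M A M A id
    by unfold_locales (rule smooth_map_id)
  show ?thesis
    using identity.coord_has_derivative[of c d x] assms by (simp add: chart_change_def)
qed

context smooth_manifold_map
begin

text \<open>Chain rule. Inserting \<open>cinv c'\<close> and \<open>cmap c'\<close> changes nothing
  over the overlap of the two charts, and the coordinate image of the overlap is open, so the
  derivative is the same.\<close>

lemma frechet_derivative_change_source:
  assumes "c \<in> A" "c' \<in> A" "d \<in> B" "x \<in> cdom c" "x \<in> cdom c'" "F x \<in> cdom d"
  shows "frechet_derivative (cmap d \<circ> F \<circ> cinv c) (at (cmap c x)) =
    frechet_derivative (cmap d \<circ> F \<circ> cinv c') (at (cmap c' x)) \<circ> chart_change x c c'"
proof -
  have "(cmap d \<circ> F \<circ> cinv c' has_derivative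
      frechet_derivative (cmap d \<circ> F \<circ> cinv c') (at (cmap c' x))) (at ((cmap c' \<circ> cinv c) (cmap c x)))"
    using coord_has_derivative[of c' d x] assms by simp
  then have "((cmap d \<circ> F \<circ> cinv c') \<circ> (cmap c' \<circ> cinv c) has_derivative
      frechet_derivative (cmap d \<circ> F \<circ> cinv c') (at (cmap c' x)) \<circ> chart_change x c c') (at (cmap c x))"
    using source.chart_change_has_derivative assms by (blast intro: diff_chain_at)
  then have "(cmap d \<circ> F \<circ> cinv c has_derivative
      frechet_derivative (cmap d \<circ> F \<circ> cinv c') (at (cmap c' x)) \<circ> chart_change x c c') (at (cmap c x))"
  proof (rule has_derivative_transform_within_open)
    show "open (cmap c ` (cdom c \<inter> cdom c'))"
      using assms by (intro source.open_cmap_image openin_Int source.chart_domain_open) auto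
  qed (use assms in auto)
  then show ?thesis by (rule frechet_derivative_at[symmetric])
qed

lemma frechet_derivative_change_target:
  assumes "c \<in> A" "d \<in> B" "d' \<in> B" "x \<in> cdom c" "F x \<in> cdom d" "F x \<in> cdom d'"
  shows "frechet_derivative (cmap d' \<circ> F \<circ> cinv c) (at (cmap c x)) =
    chart_change (F x) d d' \<circ> frechet_derivative (cmap d \<circ> F \<circ> cinv c) (at (cmap c x))"
proof -
  have "(cmap d' \<circ> cinv d has_derivative chart_change (F x) d d')
      (at ((cmap d \<circ> F \<circ> cinv c) (cmap c x)))"
    using target.chart_change_has_derivative[of d d' "F x"] assms by simp
  then have "((cmap d' \<circ> cinv d) \<circ> (cmap d \<circ> F \<circ> cinv c) has_derivative
      chart_change (F x) d d' \<circ> frechet_derivative (cmap d \<circ> F \<circ> cinv c) (at (cmap c x)))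
      (at (cmap c x))"
    using coord_has_derivative assms by (blast intro: diff_chain_at)
  then have "(cmap d' \<circ> F \<circ> cinv c has_derivative
      chart_change (F x) d d' \<circ> frechet_derivative (cmap d \<circ> F \<circ> cinv c) (at (cmap c x)))
      (at (cmap c x))"
  proof (rule has_derivative_transform_within_open)
    show "open (cmap c ` {x \<in> cdom c. F x \<in> cdom d})"
      using assms by (intro open_coord_domain)
  qed (use assms in auto)
  then show ?thesis by (rule frechet_derivative_at[symmetric])
qed

text \<open>The chain rule in the target is exactly the transformation law demanded of tangent
  vectors.\<close>

lemma differential_in_tangent_space:
  assumes "x \<in> topspace M"
  shows "differential A B F x v \<in> tangent_space B (F x)"
proof -
  let ?s = "some_chart A x"
  have "frechet_derivative (cmap d' \<circ> F \<circ> cinv ?s) (at (cmap ?s x)) (v ?s) = chart_change (F x) d d'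
      (frechet_derivative (cmap d \<circ> F \<circ> cinv ?s) (at (cmap ?s x)) (v ?s))"
    if "d \<in> B" "d' \<in> B" "F x \<in> cdom d" "F x \<in> cdom d'" for d d'
    using frechet_derivative_change_target[of ?s d d' x] source.some_chart[OF assms] that by simp
  note change = this
  show ?thesis by (simp add: tangent_space_def differential_def Let_def) (blast intro: change)
qed

text \<open>Carries the Golden identity for \<open>P\<close> through the differential.\<close>

lemma differential_add:
  assumes "x \<in> topspace M"
  shows "differential A B F x (\<lambda>c. v c + w c) =
    (\<lambda>d. differential A B F x v d + differential A B F x w d)"
proof
  fix d
  show "differential A B F x (\<lambda>c. v c + w c) d =
    differential A B F x v d + differential A B F x w d"
    using has_derivative_linear[OF coord_has_derivative, of "some_chart A x" d x]
      source.some_chart[OF assms]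
    by (auto simp: differential_def Let_def linear_add)
qed

end

section \<open>Coordinate vectors as tangent vectors\<close>

context smooth_manifold
begin

lemma chart_change_self:
  assumes "c \<in> A" "x \<in> cdom c"
  shows "chart_change x c c u = u"
proof -
  have "((\<lambda>y. y) has_derivative (\<lambda>u. u)) (at (cmap c x))" by (rule has_derivative_ident)
  then have "(cmap c \<circ> cinv c has_derivative (\<lambda>u. u)) (at (cmap c x))"
    by (rule has_derivative_transform_within_open[where s = "crange c"])
      (use assms chart_range_open in \<open>auto simp: cmap_cinv crange_def\<close>)
  then show ?thesis unfolding chart_change_def by (simp flip: frechet_derivative_at)
qed

text \<open>The cocycle rule for \<open>chart_change\<close> is the target chain rule for the
  identity map.\<close>

lemma coord_vector_in_tangent_space:
  assumes "c \<in> A" "x \<in> cdom c"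
  shows "coord_vector A c x u \<in> tangent_space A x"
proof -
  interpret identity: smooth_manifold_map M A M A id
    by unfold_locales (rule smooth_map_id)
  have "chart_change x c d' u = chart_change x d d' (chart_change x c d u)"
    if "d \<in> A" "d' \<in> A" "x \<in> cdom d" "x \<in> cdom d'" for d d'
    using identity.frechet_derivative_change_target[of c d d' x] assms that
    by (simp add: chart_change_def)
  note change = this
  show ?thesis by (simp add: tangent_space_def coord_vector_def) (blast intro: change)
qed

lemma coord_vector_self:
  "c \<in> A \<Longrightarrow> x \<in> cdom c \<Longrightarrow> coord_vector A c x u c = u"
  by (simp add: coord_vector_def chart_change_self)

end

section \<open>Maps with vanishing differential\<close>

text \<open>Local constancy makes the preimage of every set open, so two distinct values would split
  the space into a fibre and its complement.\<close>

lemma locally_constant_imp_constant_on: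
  assumes "connected_space M"
    and loc: "\<And>x. x \<in> topspace M \<Longrightarrow> \<exists>W. openin M W \<and> x \<in> W \<and> (\<forall>y\<in>W. F y = F x)"
  shows "F constant_on topspace M"
proof (rule ccontr)
  assume "\<not> F constant_on topspace M"
  then obtain a b where ab: "a \<in> topspace M" "b \<in> topspace M" "F a \<noteq> F b"
    unfolding constant_on_def by metis
  have op: "openin M {x \<in> topspace M. F x \<in> S}" for S
    unfolding openin_subopen[of M "{x \<in> topspace M. F x \<in> S}"]
  proof
    fix x assume "x \<in> {x \<in> topspace M. F x \<in> S}"
    then have x: "x \<in> topspace M" "F x \<in> S" by auto
    obtain W where W: "openin M W" "x \<in> W" "\<forall>y\<in>W. F y = F x" using loc[OF x(1)] by blast
    have "F y \<in> S" if "y \<in> W" for y using W(3) x(2) that by metis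
    then have "W \<subseteq> {x \<in> topspace M. F x \<in> S}" using openin_subset[OF W(1)] by blast
    then show "\<exists>T. openin M T \<and> x \<in> T \<and> T \<subseteq> {x \<in> topspace M. F x \<in> S}" using W by blast
  qed
  let ?E = "{x \<in> topspace M. F x \<in> {F a}}" and ?E' = "{x \<in> topspace M. F x \<in> - {F a}}"
  have "topspace M \<subseteq> ?E \<union> ?E'" "?E \<inter> ?E' = {}" by auto
  moreover have "a \<in> ?E" "b \<in> ?E'" using ab by simp_all
  then have "?E \<noteq> {}" "?E' \<noteq> {}" by (metis empty_iff)+
  ultimately have "\<exists>E1 E2. openin M E1 \<and> openin M E2 \<and> topspace M \<subseteq> E1 \<union> E2 \<and>
      E1 \<inter> E2 = {} \<and> E1 \<noteq> {} \<and> E2 \<noteq> {}"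
    using op by (intro exI[of _ ?E] exI[of _ ?E'] conjI)
  then show False using assms(1) by (simp add: connected_space_def)
qed

context smooth_manifold_map
begin

text \<open>\<open>differential\<close> is computed in \<open>some_chart A x\<close>. Testing it on
  the coordinate vectors of that chart kills the derivative there, and the source chain rule
  transfers this to any chart \<open>c\<close>.\<close>

lemma coord_derivative_zero:
  assumes "\<And>v. v \<in> tangent_space A x \<Longrightarrow> differential A B F x v = (\<lambda>d. 0)"
    and "c \<in> A" "d \<in> B" "x \<in> cdom c" "F x \<in> cdom d"
  shows "(cmap d \<circ> F \<circ> cinv c has_derivative (\<lambda>u. 0)) (at (cmap c x))"
proof -
  let ?s = "some_chart A x"
  have s: "?s \<in> A" "x \<in> cdom ?s"
    using source.some_chart source.cdom_topspace assms by blast+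
  have "frechet_derivative (cmap d \<circ> F \<circ> cinv ?s) (at (cmap ?s x)) u = 0" for u
    using fun_cong[OF assms(1)[OF source.coord_vector_in_tangent_space[OF s, of u]], of d] assms s
    by (simp add: differential_def Let_def source.coord_vector_self)
  then have "frechet_derivative (cmap d \<circ> F \<circ> cinv c) (at (cmap c x)) = (\<lambda>u. 0)"
    using frechet_derivative_change_source[of c ?s d x] assms s by (simp add: fun_eq_iff)
  then show ?thesis using coord_has_derivative[of c d x] assms by simp
qed

text \<open>In charts the derivative vanishes on a ball; the ball is convex, so the coordinate form
  of \<open>F\<close> is constant on it.\<close>

lemma constant_on_if_differential_zero:
  assumes "connected_space M"
    and zero: "\<And>x v. x \<in> topspace M \<Longrightarrow> v \<in> tangent_space A x \<Longrightarrow>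
      differential A B F x v = (\<lambda>d. 0)"
  shows "F constant_on topspace M"
  using assms(1)
proof (rule locally_constant_imp_constant_on)
  fix x assume x: "x \<in> topspace M"
  obtain c where c: "c \<in> A" "x \<in> cdom c" using source.chart_at[OF x] .
  obtain d where d: "d \<in> B" "F x \<in> cdom d" using target.chart_at[OF maps_to[OF x]] .
  let ?U = "cmap c ` {x \<in> cdom c. F x \<in> cdom d}"
  have "open ?U" "cmap c x \<in> ?U" using open_coord_domain c d by auto
  then obtain e where e: "e > 0" "ball (cmap c x) e \<subseteq> ?U" using open_contains_ball by blast
  have "(cmap d \<circ> F \<circ> cinv c has_derivative (\<lambda>u. 0)) (at y within ball (cmap c x) e)"
    if "y \<in> ball (cmap c x) e" for y
    using that e(2) coord_derivative_zero[OF zero] c d source.cdom_topspace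
    by (blast intro: has_derivative_at_withinI)
  then obtain k where k: "\<And>y. y \<in> ball (cmap c x) e \<Longrightarrow> (cmap d \<circ> F \<circ> cinv c) y = k"
    using has_derivative_zero_constant[OF convex_ball] by metis
  let ?W = "{y \<in> cdom c. cmap c y \<in> ball (cmap c x) e}"
  have "F y = F x" if y: "y \<in> ?W" for y
  proof -
    \<comment> \<open>The ball lies in the coordinate image of the points that \<open>F\<close>
      sends into \<open>cdom d\<close>; injectivity of \<open>cmap c\<close> identifies such a point
      \<open>z\<close> with \<open>y\<close>.\<close>
    obtain z where "z \<in> cdom c" "F z \<in> cdom d" "cmap c z = cmap c y"
      using y e(2) by (fastforce simp del: mem_ball)
    then have "F y \<in> cdom d"
      using y c source.inj_on_cmap[OF c(1)] by (metis (mono_tags, lifting) inj_onD mem_Collect_eq)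
    moreover have "cmap d (F y) = cmap d (F x)"
      using k[of "cmap c y"] k[of "cmap c x"] y c e(1) by simp
    ultimately show ?thesis using target.inj_on_cmap[OF d(1)] d(2) by (auto dest: inj_onD)
  qed
  moreover have "openin M ?W" using source.openin_chart_preimage c by blast
  moreover have "x \<in> ?W" using c e by simp
  ultimately show "\<exists>W. openin M W \<and> x \<in> W \<and> (\<forall>y\<in>W. F y = F x)" by blast
qed

end

section \<open>The Golden equation over the integers\<close>

text \<open>Irrationality of the Golden ratio: completing the square gives
  \<open>(2 * a - b)\<^sup>2 = 5 * b\<^sup>2\<close>, where for nonzero \<open>b\<close> the
  exponent of 5 is even on the left and odd on the right.\<close>

lemma golden_equation_int:
  fixes a b :: int
  assumes "a\<^sup>2 = a * b + b\<^sup>2"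
  shows "b = 0"
proof (rule ccontr)
  assume b: "b \<noteq> 0"
  have eq: "(2 * a - b)\<^sup>2 = 5 * b\<^sup>2" using assms by (simp add: power2_eq_square algebra_simps)
  then have ne: "2 * a - b \<noteq> 0" using b by auto
  have "multiplicity 5 ((2 * a - b)\<^sup>2) = 2 * multiplicity 5 (2 * a - b)"
    using ne by (intro prime_elem_multiplicity_power_distrib) auto
  moreover have "multiplicity 5 (5 * b\<^sup>2) = 1 + 2 * multiplicity 5 b"
    using b by (simp add: prime_elem_multiplicity_mult_distrib prime_elem_multiplicity_power_distrib)
  ultimately have "2 * multiplicity 5 (2 * a - b) = 1 + 2 * multiplicity 5 b" using eq by simp
  then show False by presburger
qed

theorem theorem4p2:
  fixes M :: "'a topology" and A :: "('a, 'e::euclidean_space) chart set"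
    and M\<^sub>1 :: "'b topology" and A\<^sub>1 :: "('b, 'f::euclidean_space) chart set"
    and F :: "'a \<Rightarrow> 'b" and p q :: nat and \<phi> :: real
  assumes "golden_riemannian_manifold M A g P"
    and "connected_space M"
    and "metallic_riemannian_manifold M\<^sub>1 A\<^sub>1 g\<^sub>1 J\<^sub>1 p q"
    and "smooth_map M A M\<^sub>1 A\<^sub>1 F"
    and "\<forall>x\<in>topspace M. \<forall>v\<in>tangent_space A x.
           differential A A\<^sub>1 F x (P x v) = J\<^sub>1 (F x) (differential A A\<^sub>1 F x v)"
    and "\<phi> = (1 + sqrt 5) / 2"
    and "real p \<noteq> real q * \<phi> + (1 - \<phi>)"
    and "real p \<noteq> real q * (1 - \<phi>) + \<phi>"
  shows "F constant_on topspace M"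
proof -
  interpret golden: golden_riemannian_manifold M A g P by fact
  interpret metallic: metallic_riemannian_manifold M\<^sub>1 A\<^sub>1 g\<^sub>1 J\<^sub>1 p q by fact
  interpret smooth_manifold_map M A M\<^sub>1 A\<^sub>1 F by unfold_locales fact
  show ?thesis
  proof (rule constant_on_if_differential_zero)
    fix x v assume x: "x \<in> topspace M" and v: "v \<in> tangent_space A x"
    define w where "w = differential A A\<^sub>1 F x v"
    define Jw where "Jw = J\<^sub>1 (F x) w"
    have w: "w \<in> tangent_space A\<^sub>1 (F x)"
      unfolding w_def by (rule differential_in_tangent_space[OF x])
    have Pv: "P x v \<in> tangent_space A x"
      using golden.tensor_field v unfolding tensor_field_11_def by blast
    have FPv: "differential A A\<^sub>1 F x (P x v) = Jw"
      using assms(5) x v by (simp add: Jw_def w_def)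
    have Jw: "Jw \<in> tangent_space A\<^sub>1 (F x)"
      using differential_in_tangent_space[OF x] FPv by metis
    have "J\<^sub>1 (F x) Jw = differential A A\<^sub>1 F x (P x (P x v))"
      using assms(5) x Pv FPv by simp
    then have J2_golden: "J\<^sub>1 (F x) Jw = (\<lambda>d. Jw d + w d)"
      using golden.golden[OF x v] differential_add[OF x] FPv w_def by simp
    have J2_metallic: "J\<^sub>1 (F x) Jw = (\<lambda>d. real p *\<^sub>R Jw d + real q *\<^sub>R w d)"
      using metallic.metallic[OF maps_to[OF x] w] by (simp add: Jw_def)
    let ?a = "1 - real q" and ?b = "real p - 1"
    have Jw_w: "?b *\<^sub>R Jw d = ?a *\<^sub>R w d" for d
      using fun_cong[OF J2_golden, of d] fun_cong[OF J2_metallic, of d]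
      by (simp add: algebra_simps)
    have w_zero: "w d = 0" for d
    proof (cases "p = 1")
      case True
      \<comment> \<open>For \<open>q = 1\<close> the excluded value
        \<open>q * \<phi> + (1 - \<phi>)\<close> would be 1, that is, \<open>p\<close>.\<close>
      then have "q \<noteq> 1" using assms(7) by auto
      then show ?thesis using Jw_w[of d] True by simp
    next
      case False
      \<comment> \<open>Apply \<open>J\<^sub>1\<close> to \<open>Jw_w\<close>. The zero summands
        bring both sides into the two-term form in which \<open>tensor_field_11\<close> states
        linearity.\<close>
      have "J\<^sub>1 (F x) (\<lambda>d. ?b *\<^sub>R Jw d + 0 *\<^sub>R Jw d) = J\<^sub>1 (F x) (\<lambda>d. ?a *\<^sub>R w d + 0 *\<^sub>R w d)"
        using Jw_w by simp
      moreover have "J\<^sub>1 (F x) (\<lambda>d. ?b *\<^sub>R Jw d + 0 *\<^sub>R Jw d) =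
          (\<lambda>d. ?b *\<^sub>R J\<^sub>1 (F x) Jw d + 0 *\<^sub>R J\<^sub>1 (F x) Jw d)"
        using metallic.tensor_field Jw unfolding tensor_field_11_def by blast
      moreover have "J\<^sub>1 (F x) (\<lambda>d. ?a *\<^sub>R w d + 0 *\<^sub>R w d) =
          (\<lambda>d. ?a *\<^sub>R J\<^sub>1 (F x) w d + 0 *\<^sub>R J\<^sub>1 (F x) w d)"
        using metallic.tensor_field w unfolding tensor_field_11_def by blast
      ultimately have "(\<lambda>d. ?b *\<^sub>R (Jw d + w d)) = (\<lambda>d. ?a *\<^sub>R Jw d)"
        using J2_golden by (simp add: Jw_def)
      from fun_cong[OF this, of d] have "?b *\<^sub>R (Jw d + w d) = ?a *\<^sub>R Jw d" .
      \<comment> \<open>Multiplying by \<open>?b\<close> lets \<open>Jw_w\<close> eliminate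
        \<open>Jw\<close>, leaving a scalar equation on \<open>w\<close> alone.\<close>
      then have "?b *\<^sub>R (?b *\<^sub>R Jw d + ?b *\<^sub>R w d) = ?a *\<^sub>R (?b *\<^sub>R Jw d)"
        by (metis scaleR_add_right scaleR_left_commute)
      then have "(?a * ?b + ?b\<^sup>2 - ?a\<^sup>2) *\<^sub>R w d = 0"
        unfolding Jw_w scaleR_add_right scaleR_scaleR power2_eq_square
        by (simp only: scaleR_left.add scaleR_left.diff mult.commute[of ?b ?a] diff_eq_eq add_0)
      moreover have "?a * ?b + ?b\<^sup>2 - ?a\<^sup>2 \<noteq> 0"
      proof
        assume "?a * ?b + ?b\<^sup>2 - ?a\<^sup>2 = 0"
        \<comment> \<open>The scalar equation is the Golden equation for \<open>1 - q\<close> and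
          \<open>p - 1\<close>, taken over the integers since \<open>1 - q\<close> may be
          negative.\<close>
        then have "real_of_int ((1 - int q)\<^sup>2) =
            real_of_int ((1 - int q) * (int p - 1) + (int p - 1)\<^sup>2)" by simp
        then have "int p - 1 = 0" by (intro golden_equation_int) (simp only: of_int_eq_iff)
        with False show False by simp
      qed
      ultimately show ?thesis by simp
    qed
    then show "differential A A\<^sub>1 F x v = (\<lambda>d. 0)" by (auto simp: w_def)
  qed fact
qed

end
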